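(* For $q>1$ and $|u|<1/q$, $$\sum_{n \geq 0} q^{n^2}u^n \left[ \sum_{\substack{0\le r\le n\\ r \text{ even}}} \frac{1}{A_r} + \sum_{\substack{1\le r\le n\\ r \text{ even}}} \frac{1}{B_r} + \sum_{\substack{1\le r\le n\\ r \text{ odd}}} \frac{1}{C_r} \right] = \frac{1}{2(1-uq)} \frac{\prod_{i \geq 1} (1+u/q^{2(i-1)})}{\prod_{i \geq 1} (1-u^2/q^{2(i-1)})} + \frac{1}{2} \frac{\prod_{i \geq 1} (1+u/q^{2i-1})}{\prod_{i \geq 1} (1-u^2/q^{2(i-1)})},$$ where (depending on $n$) $$A_r = q^{r(r-1)/2+r(2n-2r)}\, |Sp(r,q)|\, |O^+(2n-2r,q)|,$$ $$B_r = 2q^{r(r+1)/2+(r-1)(2n-2r)-1}\, |Sp(r-2,q)|\, |Sp(2n-2r,q)|,$$ $$C_r = 2q^{r(r-1)/2+(r-1)(2n-2r)}\, |Sp(r-1,q)|\, |Sp(2n-2r,q)|.$$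
   Context: Here $q$ is a real number, $u$ is a complex number, and the following symbols denote expressions in $q$ (which for prime powers $q$ are orders of finite classical groups): $|Sp(2m,q)|=q^{m^2}\prod_{i=1}^m (q^{2i}-1)$ for $m\ge 0$ (so $|Sp(0,q)|=1$); $|O^{+}(2m,q)|=\frac{2q^{m^2-m}}{q^m+ 1}\prod_{i=1}^m (q^{2i}-1)$ for $m\ge 1$, and $|O^+(0,q)|=1$. *)

theory Defs
  imports "HOL-Analysis.Analysis"
begin

text \<open>
  The first argument of \<open>card_Sp\<close> and \<open>card_O_plus\<close> is the dimension \<open>d = 2m\<close> of the
  underlying space, as in the notation \<open>|Sp(2m,q)|\<close>. Only even \<open>d\<close> are meaningful.
  The parameter \<open>q\<close> is an arbitrary real number.
\<close>

definition card_Sp :: "nat \<Rightarrow> real \<Rightarrow> real" where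
  "card_Sp d q = (let m = d div 2 in q ^ (m\<^sup>2) * (\<Prod>i=1..m. q ^ (2 * i) - 1))"

definition card_O_plus :: "nat \<Rightarrow> real \<Rightarrow> real" where
  "card_O_plus d q = (let m = d div 2 in
     if m = 0 then 1
     else 2 * q ^ (m\<^sup>2 - m) / (q ^ m + 1) * (\<Prod>i=1..m. q ^ (2 * i) - 1))"

text \<open>
  All exponents below are natural numbers. In the ranges where the three
  quantities are used, namely \<open>r \<le> n\<close> with \<open>r\<close> even for \<open>A\<close>, \<open>r \<ge> 2\<close> even for \<open>B\<close> and
  \<open>r\<close> odd for \<open>C\<close>, no subtraction truncates (in \<open>A\<close> the case \<open>r = 0\<close> gives
  \<open>0 * (0 - 1) = 0\<close>) and the divisions by 2 are exact.
\<close>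

definition A_term :: "real \<Rightarrow> nat \<Rightarrow> nat \<Rightarrow> real" where
  "A_term q n r = q ^ (r * (r - 1) div 2 + r * (2 * n - 2 * r))
     * card_Sp r q * card_O_plus (2 * n - 2 * r) q"

definition B_term :: "real \<Rightarrow> nat \<Rightarrow> nat \<Rightarrow> real" where
  "B_term q n r = 2 * q ^ (r * (r + 1) div 2 + (r - 1) * (2 * n - 2 * r) - 1)
     * card_Sp (r - 2) q * card_Sp (2 * n - 2 * r) q"

definition C_term :: "real \<Rightarrow> nat \<Rightarrow> nat \<Rightarrow> real" where
  "C_term q n r = 2 * q ^ (r * (r - 1) div 2 + (r - 1) * (2 * n - 2 * r))
     * card_Sp (r - 1) q * card_Sp (2 * n - 2 * r) q"

text \<open>
  The infinite products \<open>\<Prod>i\<ge>1\<close> are written with \<open>prodinf\<close>, shifting the index to start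
  at 0. The constant \<open>prodinf\<close> is unspecified on divergent products; the following
  lemma covers all the products that are used, with \<open>c = u\<close>, \<open>c = u / q\<close> and
  \<open>c = - u\<^sup>2\<close>.
\<close>

lemma convergent_prod_one_plus_geometric:
  fixes q :: real and c :: complex
  assumes "q > 1"
  shows "convergent_prod (\<lambda>i. 1 + c / complex_of_real q ^ (2 * i))"
proof -
  have "norm (1 / q\<^sup>2) < 1"
    using assms by (simp add: abs_square_less_1 power_less_one_iff one_less_power)
  then have "summable (\<lambda>i. norm c * (1 / q\<^sup>2) ^ i)"
    by (intro summable_mult summable_geometric)
  moreover have "(\<lambda>i. norm c * (1 / q\<^sup>2) ^ i) = (\<lambda>i. norm (1 + c / complex_of_real q ^ (2 * i) - 1))"
    using assms by (auto simp: norm_divide norm_power power_mult power_divide)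
  ultimately have "summable (\<lambda>i. norm (1 + c / complex_of_real q ^ (2 * i) - 1))"
    by simp
  then show ?thesis
    by (intro abs_convergent_prod_imp_convergent_prod summable_imp_abs_convergent_prod)
qed

end

theory Submission
  imports Defs
begin

text \<open>
  With \<open>p = 1 / q\<^sup>2\<close> and \<open>m = n - r\<close>, all powers of \<open>q\<close> in the summands collapse:
  \<open>q\<^bsup>n\<^sup>2\<^esup> / A\<^sub>r\<close>, \<open>q\<^bsup>n\<^sup>2\<^esup> / B\<^sub>r\<close> and \<open>q\<^bsup>n\<^sup>2\<^esup> / C\<^sub>r\<close> are products of a factor depending on \<open>r\<close>
  and a factor depending on \<open>m\<close>. Hence the generating function is a sum of two Cauchy
  products, whose factors are given by Euler's expansions of
  \<open>F z = 1 / (\<Prod>i. 1 - z * p ^ i)\<close> and \<open>\<Prod>i. 1 + z * p ^ i\<close>. The \<open>B\<close> and \<open>C\<close> sums involve the first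
  expansion at \<open>z = u\<^sup>2 * q\<^sup>2\<close>, and the functional equation \<open>F (p * z) = (1 - z) * F z\<close>
  brings it to \<open>z = u\<^sup>2\<close> at the cost of the factor \<open>1 - u\<^sup>2 * q\<^sup>2\<close>.
\<close>

section \<open>The q-factorial and absolute convergence of Euler's series\<close>

text \<open>The finite q-Pochhammer symbol \<open>(p; p)_k\<close>. It is kept over an arbitrary
  field because the group orders need it at a real \<open>p\<close> and the series at a complex
  one.\<close>

definition qfac :: "'a::field \<Rightarrow> nat \<Rightarrow> 'a" where
  "qfac p k = (\<Prod>i=1..k. 1 - p ^ i)"

lemma qfac_0 [simp]: "qfac p 0 = 1"
  by (simp add: qfac_def)

lemma qfac_Suc: "qfac p (Suc k) = qfac p k * (1 - p ^ Suc k)"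
  by (simp add: qfac_def)

text \<open>Excludes zero factors in \<open>qfac\<close>, so that its top factor can be cancelled in
  the functional equations.\<close>

lemma power_neq_1_of_norm_less_1:
  fixes p :: "'a::real_normed_div_algebra"
  assumes "norm p < 1"
  shows "p ^ Suc k \<noteq> 1"
proof
  assume "p ^ Suc k = 1"
  from power_eq_1_iff[OF this] assms show False
    by simp
qed

lemma of_real_qfac: "of_real (qfac p k) = qfac (of_real p) k"
  by (simp add: qfac_def)

text \<open>Writing the ratio as a product admits vanishing terms, such as those of Euler's series
  at \<open>z = 0\<close>. Any constant strictly between \<open>l\<close> and 1 eventually bounds
  \<open>g\<close>, and the ratio test applies.\<close>

lemma summable_norm_ratio_limit:
  fixes f :: "nat \<Rightarrow> 'a::real_normed_vector"
  assumes ratio: "\<And>n. norm (f (Suc n)) = g n * norm (f n)"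
    and lim: "g \<longlonglongrightarrow> l" and "l < 1"
  shows "summable (\<lambda>n. norm (f n))"
proof -
  obtain c where c: "l < c" "c < 1"
    using dense[OF \<open>l < 1\<close>] by blast
  obtain N where N: "\<And>n. n \<ge> N \<Longrightarrow> g n < c"
    using order_tendstoD(2)[OF lim c(1)] unfolding eventually_sequentially by blast
  show ?thesis
  proof (rule summable_ratio_test[OF c(2)])
    fix n assume "n \<ge> N"
    then have "norm (f (Suc n)) \<le> c * norm (f n)"
      unfolding ratio using N[of n] by (intro mult_right_mono) auto
    then show "norm (norm (f (Suc n))) \<le> c * norm (norm (f n))"
      by simp
  qed
qed

lemma summable_norm_euler_inverse:
  fixes p z :: complex
  assumes p: "norm p < 1" and z: "norm z < 1"
  shows "summable (\<lambda>k. norm (z ^ k / qfac p k))"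
proof (rule summable_norm_ratio_limit)
  show "norm (z ^ Suc k / qfac p (Suc k))
      = norm z / norm (1 - p ^ Suc k) * norm (z ^ k / qfac p k)" for k
    by (simp add: qfac_Suc norm_mult norm_divide norm_power)
  have "(\<lambda>k. p ^ Suc k) \<longlonglongrightarrow> 0"
    using LIMSEQ_power_zero[OF p] by (rule LIMSEQ_Suc)
  then have "(\<lambda>k. norm z / norm (1 - p ^ Suc k)) \<longlonglongrightarrow> norm z / norm (1 - 0 :: complex)"
    by (intro tendsto_intros) auto
  then show "(\<lambda>k. norm z / norm (1 - p ^ Suc k)) \<longlonglongrightarrow> norm z"
    by simp
qed (fact z)

text \<open>The extra factor \<open>p ^ m\<close> in the ratio of consecutive terms drives it to 0,
  whence no bound on \<open>z\<close>.\<close>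

lemma summable_norm_euler_prod:
  fixes p z :: complex
  assumes p: "norm p < 1"
  shows "summable (\<lambda>m. norm (p ^ (m choose 2) * z ^ m / qfac p m))"
proof (rule summable_norm_ratio_limit)
  show "norm (p ^ (Suc m choose 2) * z ^ Suc m / qfac p (Suc m))
      = norm (p ^ m * z) / norm (1 - p ^ Suc m) * norm (p ^ (m choose 2) * z ^ m / qfac p m)" for m
    by (simp add: qfac_Suc norm_mult norm_divide norm_power numeral_2_eq_2 power_add mult_ac)
  have "(\<lambda>m. p ^ m * z) \<longlonglongrightarrow> 0 * z"
    by (intro tendsto_mult LIMSEQ_power_zero tendsto_const p)
  moreover have "(\<lambda>m. p ^ Suc m) \<longlonglongrightarrow> 0"
    using LIMSEQ_power_zero[OF p] by (rule LIMSEQ_Suc)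
  ultimately have "(\<lambda>m. norm (p ^ m * z) / norm (1 - p ^ Suc m))
      \<longlonglongrightarrow> norm (0 * z) / norm (1 - 0 :: complex)"
    by (intro tendsto_divide tendsto_norm tendsto_diff tendsto_const) auto
  then show "(\<lambda>m. norm (p ^ m * z) / norm (1 - p ^ Suc m)) \<longlonglongrightarrow> 0"
    by simp
qed simp

section \<open>Functional equations and Euler's product expansions\<close>

text \<open>Convergence at a single nonzero point \<open>K\<close> makes the power series continuous
  at 0, and \<open>p ^ N * z\<close> tends to 0. This evaluates the limit left over when a
  functional equation is iterated.\<close>

lemma powser_tendsto_at_geometric:
  fixes c :: "nat \<Rightarrow> complex" and p z :: complex
  assumes p: "norm p < 1" and c: "summable (\<lambda>n. c n * K ^ n)" and K: "K \<noteq> 0"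
  shows "(\<lambda>N. \<Sum>n. c n * (p ^ N * z) ^ n) \<longlonglongrightarrow> c 0"
proof -
  have cont: "isCont (\<lambda>x. \<Sum>n. c n * x ^ n) 0"
    using c K by (intro isCont_powser) auto
  have "(\<lambda>N. p ^ N * z) \<longlonglongrightarrow> 0 * z"
    by (intro tendsto_mult LIMSEQ_power_zero tendsto_const p)
  then have "(\<lambda>N. p ^ N * z) \<longlonglongrightarrow> 0"
    by simp
  from isCont_tendsto_compose[OF cont this] show ?thesis
    by (simp add: powser_zero)
qed

lemma convergent_prod_geometric:
  fixes p z :: complex
  assumes "norm p < 1"
  shows "convergent_prod (\<lambda>i. 1 + z * p ^ i)"
proof -
  have "summable (\<lambda>i. norm z * norm p ^ i)"
    using assms by (intro summable_mult summable_geometric) simp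
  then have "summable (\<lambda>i. norm (1 + z * p ^ i - 1))"
    by (simp add: norm_mult norm_power)
  then show ?thesis
    by (intro abs_convergent_prod_imp_convergent_prod summable_imp_abs_convergent_prod)
qed

lemma LIMSEQ_prod_geometric:
  fixes p z :: complex
  assumes "norm p < 1"
  shows "(\<lambda>N. \<Prod>i<N. 1 + z * p ^ i) \<longlonglongrightarrow> (\<Prod>i. 1 + z * p ^ i)"
  using convergent_prod_LIMSEQ[OF convergent_prod_geometric[OF assms, of z]]
  by (simp only: LIMSEQ_lessThan_iff_atMost[where f = "prod (\<lambda>i. 1 + z * p ^ i)"])

text \<open>In the difference of the two series the constant terms cancel, and
  \<open>z ^ k - (p * z) ^ k = z ^ k * (1 - p ^ k)\<close> removes the top factor of
  \<open>qfac p k\<close>. What remains is the first series shifted by one, that is, multiplied by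
  \<open>z\<close>.\<close>

lemma euler_inverse_functional_equation:
  fixes p z :: complex
  assumes p: "norm p < 1" and z: "norm z < 1"
  shows "(\<Sum>k. (p * z) ^ k / qfac p k) = (1 - z) * (\<Sum>k. z ^ k / qfac p k)"
proof -
  have "norm (p * z) < 1"
    using p z by (metis norm_mult norm_ge_zero mult_strict_mono' mult_1)
  note S = summable_norm_cancel[OF summable_norm_euler_inverse[OF p z]]
    and Sp = summable_norm_cancel[OF summable_norm_euler_inverse[OF p this]]
  have "(\<Sum>k. z ^ k / qfac p k) - (\<Sum>k. (p * z) ^ k / qfac p k)
      = (\<Sum>k. z ^ k / qfac p k - (p * z) ^ k / qfac p k)"
    by (rule suminf_diff[OF S Sp])
  also have "\<dots> = (\<Sum>k. z ^ Suc k / qfac p (Suc k) - (p * z) ^ Suc k / qfac p (Suc k))"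
    by (subst suminf_split_head[OF summable_diff[OF S Sp]]) simp
  also have "\<dots> = (\<Sum>k. z * (z ^ k / qfac p k))"
  proof (rule suminf_cong)
    fix k
    have "z ^ Suc k / qfac p (Suc k) - (p * z) ^ Suc k / qfac p (Suc k)
        = z ^ Suc k * (1 - p ^ Suc k) / qfac p (Suc k)"
      by (simp only: power_mult_distrib right_diff_distrib diff_divide_distrib mult.commute mult_1)
    then show "z ^ Suc k / qfac p (Suc k) - (p * z) ^ Suc k / qfac p (Suc k) = z * (z ^ k / qfac p k)"
      using power_neq_1_of_norm_less_1[OF p, of k] by (simp add: qfac_Suc)
  qed
  also have "\<dots> = z * (\<Sum>k. z ^ k / qfac p k)"
    by (rule suminf_mult[OF S])
  finally show ?thesis
    by (simp add: algebra_simps)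
qed

text \<open>Iterating the functional equation \<open>N\<close> times collects the partial product on
  the right, while the series at \<open>p ^ N * z\<close> tends to its constant term 1.\<close>

lemma euler_inverse_sums:
  fixes p z :: complex
  assumes p: "norm p < 1" and z: "norm z < 1"
  shows "(\<lambda>k. z ^ k / qfac p k) sums (1 / (\<Prod>i. 1 - z * p ^ i))"
proof -
  let ?F = "\<lambda>z. \<Sum>k. z ^ k / qfac p k"
  have less: "norm (p ^ N * z) < 1" for N
  proof -
    have "norm (p ^ N * z) \<le> norm z"
      using p by (simp add: norm_mult norm_power mult_left_le_one_le power_le_one)
    with z show ?thesis by simp
  qed
  have step: "?F (p ^ N * z) = (\<Prod>i<N. 1 - z * p ^ i) * ?F z" for N
  proof (induction N)
    case (Suc N)
    have "?F (p ^ Suc N * z) = (1 - p ^ N * z) * ?F (p ^ N * z)"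
      using euler_inverse_functional_equation[OF p less[of N]] by (simp add: mult.assoc)
    then show ?case
      using Suc by (simp add: mult_ac)
  qed simp
  \<comment> \<open>Any nonzero point of the unit disc would serve in place of
    \<open>1 / 2\<close>.\<close>
  have "summable (\<lambda>k. 1 / qfac p k * (1 / 2) ^ k)"
    using summable_norm_cancel[OF summable_norm_euler_inverse[OF p, of "1 / 2"]] by simp
  from powser_tendsto_at_geometric[OF p this, of z]
  have "(\<lambda>N. ?F (p ^ N * z)) \<longlonglongrightarrow> 1"
    by simp
  moreover have "(\<lambda>N. ?F (p ^ N * z)) \<longlonglongrightarrow> (\<Prod>i. 1 - z * p ^ i) * ?F z"
    unfolding step using LIMSEQ_prod_geometric[OF p, of "- z"]
    by (intro tendsto_intros) simp
  ultimately have "(\<Prod>i. 1 - z * p ^ i) * ?F z = 1"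
    using LIMSEQ_unique by blast
  \<comment> \<open>The product is nonzero because its product with \<open>?F z\<close> is 1; no
    separate argument for nonvanishing is required.\<close>
  then have "?F z = 1 / (\<Prod>i. 1 - z * p ^ i)"
    by (metis mult_zero_left nonzero_mult_div_cancel_left zero_neq_one)
  then show ?thesis
    using summable_norm_cancel[OF summable_norm_euler_inverse[OF p z]] by (metis summable_sums)
qed

text \<open>Here the functional equation is \<open>G z = (1 + z) * G (p * z)\<close>, valid for
  every \<open>z\<close> because the series converges everywhere. Iteration splits off the partial
  product, and the remaining factor tends to 1.\<close>

lemma euler_prod_sums:
  fixes p z :: complex
  assumes p: "norm p < 1"
  shows "(\<lambda>m. p ^ (m choose 2) * z ^ m / qfac p m) sums (\<Prod>i. 1 + z * p ^ i)"
proof -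
  let ?G = "\<lambda>z. \<Sum>m. p ^ (m choose 2) * z ^ m / qfac p m"
  have S: "summable (\<lambda>m. p ^ (m choose 2) * z ^ m / qfac p m)" for z
    by (rule summable_norm_cancel[OF summable_norm_euler_prod[OF p]])
  have func: "?G z = (1 + z) * ?G (p * z)" for z
  proof -
    have "?G z - ?G (p * z)
        = (\<Sum>m. p ^ (m choose 2) * z ^ m / qfac p m - p ^ (m choose 2) * (p * z) ^ m / qfac p m)"
      by (rule suminf_diff[OF S S])
    also have "\<dots> = (\<Sum>m. p ^ (Suc m choose 2) * z ^ Suc m / qfac p (Suc m)
        - p ^ (Suc m choose 2) * (p * z) ^ Suc m / qfac p (Suc m))"
      by (subst suminf_split_head[OF summable_diff[OF S S]]) simp
    also have "\<dots> = (\<Sum>m. z * (p ^ (m choose 2) * (p * z) ^ m / qfac p m))"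
    proof (rule suminf_cong)
      fix m
      have "(p * z) ^ Suc m = z ^ Suc m * p ^ Suc m"
        by (simp only: power_mult_distrib mult.commute)
      then have "p ^ (Suc m choose 2) * z ^ Suc m / qfac p (Suc m)
          - p ^ (Suc m choose 2) * (p * z) ^ Suc m / qfac p (Suc m)
          = p ^ (Suc m choose 2) * z ^ Suc m * (1 - p ^ Suc m) / qfac p (Suc m)"
        by (simp only: diff_divide_distrib right_diff_distrib mult.assoc mult_1_right)
      \<comment> \<open>Since \<open>Suc m choose 2 = m + (m choose 2)\<close>, a factor
        \<open>p ^ m\<close> is released and turns \<open>z ^ m\<close> into
        \<open>(p * z) ^ m\<close>.\<close>
      also have "\<dots> = z * (p ^ (m choose 2) * (p * z) ^ m / qfac p m)"
        using power_neq_1_of_norm_less_1[OF p, of m]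
        by (simp add: qfac_Suc numeral_2_eq_2 power_add power_mult_distrib)
      finally show "p ^ (Suc m choose 2) * z ^ Suc m / qfac p (Suc m)
          - p ^ (Suc m choose 2) * (p * z) ^ Suc m / qfac p (Suc m)
          = z * (p ^ (m choose 2) * (p * z) ^ m / qfac p m)" .
    qed
    also have "\<dots> = z * ?G (p * z)"
      by (rule suminf_mult[OF S])
    finally show ?thesis
      by (simp add: algebra_simps)
  qed
  have step: "?G z = (\<Prod>i<N. 1 + z * p ^ i) * ?G (p ^ N * z)" for N
  proof (induction N)
    case (Suc N)
    have "?G (p ^ N * z) = (1 + p ^ N * z) * ?G (p ^ Suc N * z)"
      using func[of "p ^ N * z"] by (simp add: mult.assoc)
    then show ?case
      using Suc by (simp add: mult_ac)
  qed simp
  have "summable (\<lambda>m. p ^ (m choose 2) / qfac p m * 1 ^ m)"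
    using S[of 1] by simp
  from powser_tendsto_at_geometric[OF p this, of z]
  have "(\<lambda>N. ?G (p ^ N * z)) \<longlonglongrightarrow> 1"
    by (simp add: binomial_eq_0)
  then have "(\<lambda>N. (\<Prod>i<N. 1 + z * p ^ i) * ?G (p ^ N * z)) \<longlonglongrightarrow> (\<Prod>i. 1 + z * p ^ i) * 1"
    using LIMSEQ_prod_geometric[OF p, of z] by (intro tendsto_intros)
  then have "?G z = (\<Prod>i. 1 + z * p ^ i)"
    unfolding step[symmetric] by (simp add: LIMSEQ_const_iff)
  then show ?thesis
    using S by (metis summable_sums)
qed

section \<open>Group orders as powers of q times q-factorials\<close>

text \<open>Each factor releases \<open>q ^ (2 * i)\<close>, and these exponents add up to
  \<open>m * (m + 1)\<close>.\<close>

lemma prod_pow_minus_one: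
  fixes q :: real
  assumes "q > 1"
  shows "(\<Prod>i=1..m. q ^ (2 * i) - 1) = q ^ (m\<^sup>2 + m) * qfac (1 / q\<^sup>2) m"
proof (induction m)
  case (Suc m)
  have "q ^ (2 * Suc m) - 1 = q ^ (2 * Suc m) * (1 - (1 / q\<^sup>2) ^ Suc m)"
    unfolding power_mult power_one_over using assms
    by (simp add: right_diff_distrib del: power_Suc)
  moreover have "(Suc m)\<^sup>2 + Suc m = m\<^sup>2 + m + 2 * Suc m"
    by (simp add: power2_eq_square)
  ultimately show ?case
    using Suc by (simp only: qfac_Suc power_add prod.cl_ivl_Suc mult_ac) simp
qed simp

lemma card_Sp_eq:
  assumes "q > 1"
  shows "card_Sp (2 * m) q = q ^ (2 * m\<^sup>2 + m) * qfac (1 / q\<^sup>2) m"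
proof -
  have "m\<^sup>2 + (m\<^sup>2 + m) = 2 * m\<^sup>2 + m"
    by simp
  then have "q ^ (m\<^sup>2) * q ^ (m\<^sup>2 + m) = q ^ (2 * m\<^sup>2 + m)"
    by (metis power_add)
  then show ?thesis
    using prod_pow_minus_one[OF assms, of m] by (simp add: card_Sp_def Let_def)
qed

text \<open>At \<open>m = 0\<close> the right-hand side is \<open>2 / 2 = 1\<close>, so one formula
  also covers the separately defined trivial case and the summand with \<open>r = n\<close> needs no
  special treatment.\<close>

lemma card_O_plus_eq:
  assumes "q > 1"
  shows "card_O_plus (2 * m) q = 2 * q ^ (2 * m\<^sup>2) * qfac (1 / q\<^sup>2) m / (q ^ m + 1)"
proof (cases "m = 0")
  case False
  have "m\<^sup>2 - m + (m\<^sup>2 + m) = 2 * m\<^sup>2"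
    by (simp add: power2_eq_square le_square)
  then have "q ^ (m\<^sup>2 - m) * q ^ (m\<^sup>2 + m) = q ^ (2 * m\<^sup>2)"
    by (metis power_add)
  then show ?thesis
    using False prod_pow_minus_one[OF assms, of m]
    by (simp add: card_O_plus_def Let_def)
qed (simp add: card_O_plus_def)

lemma real_qfac_pos:
  fixes q :: real
  assumes "q > 1"
  shows "qfac (1 / q\<^sup>2) k > 0"
  unfolding qfac_def
proof (intro prod_pos)
  fix i assume "i \<in> {1..k}"
  then have "1 < (q\<^sup>2) ^ i"
    using assms by (intro one_less_power) auto
  then show "0 < 1 - (1 / q\<^sup>2) ^ i"
    using assms by (simp add: power_one_over)
qed

text \<open>Links the squares in the group orders to the exponent \<open>m choose 2\<close> of
  Euler's series without division or subtraction.\<close>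

lemma choose_two_double: "2 * (m choose 2) + m = m\<^sup>2"
proof (induction m)
  case (Suc m)
  have "Suc m choose 2 = m + (m choose 2)"
    by (simp add: numeral_2_eq_2)
  with Suc show ?case
    by (simp add: power2_eq_square)
qed simp

section \<open>Separation of the summands into factors in r and in n - r\<close>

text \<open>With \<open>n = 2 * k + m\<close> the powers of \<open>q\<close> in the numerator of
  \<open>A_term\<close> have total exponent \<open>n^2 + m^2\<close>. After \<open>q ^ (n^2)\<close>
  cancels, \<open>q ^ m + 1\<close> divided by \<open>q ^ (m^2)\<close> is
  \<open>p ^ (m choose 2) * (1 + q ^ (-m))\<close> with \<open>p = 1 / q^2\<close>; its two summands
  lead to the products at \<open>u\<close> and \<open>u / q\<close>.\<close>

lemma A_term_factor:
  assumes q: "q > 1"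
  shows "q ^ ((2 * k + m)\<^sup>2) / A_term q (2 * k + m) (2 * k)
    = 1 / qfac (1 / q\<^sup>2) k
      * (1 / 2 * ((1 / q\<^sup>2) ^ (m choose 2) * (1 + (1 / q) ^ m) / qfac (1 / q\<^sup>2) m))"
proof -
  let ?N = "(2 * k + m)\<^sup>2" and ?c = "m choose 2"
  have c: "2 * ?c + m = m\<^sup>2"
    by (rule choose_two_double)
  \<comment> \<open>Adding \<open>k\<close> disposes of the natural-number subtraction, which
    truncates at \<open>k = 0\<close>.\<close>
  have "k * (2 * k - 1) + k = 2 * k\<^sup>2"
    by (cases k) (simp_all add: power2_eq_square)
  moreover have "?N = 4 * k\<^sup>2 + 2 * k * (2 * m) + m\<^sup>2"
    by (simp add: power2_eq_square algebra_simps)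
  ultimately have "k * (2 * k - 1) + 2 * k * (2 * m) + (2 * k\<^sup>2 + k) + 2 * m\<^sup>2 = ?N + m\<^sup>2"
    by linarith
  then have E: "q ^ (k * (2 * k - 1) + 2 * k * (2 * m)) * q ^ (2 * k\<^sup>2 + k) * q ^ (2 * m\<^sup>2)
      = q ^ ?N * ((q\<^sup>2) ^ ?c * q ^ m)"
    by (simp only: power_add[symmetric] power_mult[symmetric] c)
  have "A_term q (2 * k + m) (2 * k)
      = q ^ (k * (2 * k - 1) + 2 * k * (2 * m)) * (q ^ (2 * k\<^sup>2 + k) * qfac (1 / q\<^sup>2) k)
        * (2 * q ^ (2 * m\<^sup>2) * qfac (1 / q\<^sup>2) m / (q ^ m + 1))"
  proof -
    have "2 * k * (2 * k - 1) div 2 = k * (2 * k - 1)" "2 * (2 * k + m) - 2 * (2 * k) = 2 * m"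
      by simp_all
    then show ?thesis
      unfolding A_term_def card_Sp_eq[OF q] by (simp only: card_O_plus_eq[OF q])
  qed
  also have "\<dots> = (q ^ (k * (2 * k - 1) + 2 * k * (2 * m)) * q ^ (2 * k\<^sup>2 + k) * q ^ (2 * m\<^sup>2))
      * (2 * qfac (1 / q\<^sup>2) k * qfac (1 / q\<^sup>2) m / (q ^ m + 1))"
    by (simp add: mult_ac)
  finally have A: "A_term q (2 * k + m) (2 * k) = q ^ ?N * ((q\<^sup>2) ^ ?c * q ^ m)
      * (2 * qfac (1 / q\<^sup>2) k * qfac (1 / q\<^sup>2) m / (q ^ m + 1))"
    unfolding E .
  have "1 + (1 / q) ^ m = (q ^ m + 1) / q ^ m"
    using q by (simp add: power_one_over field_simps)
  then show ?thesis
    unfolding A using q by (simp add: power_one_over)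
qed

text \<open>The exponents in \<open>B_term\<close> together with \<open>r = 2 * k + 2\<close> add up
  to \<open>n^2 + 2 * (m choose 2)\<close>. The missing \<open>q ^ r\<close> becomes the numerator
  of the factor in \<open>r\<close>, later joined with \<open>u ^ r\<close>.\<close>

lemma B_term_factor:
  assumes q: "q > 1"
  shows "q ^ ((2 * k + 2 + m)\<^sup>2) / B_term q (2 * k + 2 + m) (2 * k + 2)
    = q ^ (2 * k + 2) / qfac (1 / q\<^sup>2) k
      * (1 / 2 * ((1 / q\<^sup>2) ^ (m choose 2) / qfac (1 / q\<^sup>2) m))"
proof -
  let ?N = "(2 * k + 2 + m)\<^sup>2" and ?c = "m choose 2"
  let ?e = "(k + 1) * (2 * k + 3) + (2 * k + 1) * (2 * m) - 1"
  have c: "2 * ?c + m = m\<^sup>2"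
    by (rule choose_two_double)
  \<comment> \<open>The subtraction in \<open>?e\<close> does not truncate, because
    \<open>(k + 1) * (2 * k + 3)\<close> is at least 3.\<close>
  have "?e + 1 = (k + 1) * (2 * k + 3) + (2 * k + 1) * (2 * m)"
    by simp
  then have "?e + (2 * k\<^sup>2 + k) + (2 * m\<^sup>2 + m) + (2 * k + 2) = ?N + 2 * ?c"
    using c by (simp add: power2_eq_square algebra_simps)
  then have E: "q ^ ?e * q ^ (2 * k\<^sup>2 + k) * q ^ (2 * m\<^sup>2 + m) * q ^ (2 * k + 2) = q ^ ?N * (q\<^sup>2) ^ ?c"
    unfolding power_add[symmetric] power_mult[symmetric] by simp
  have "B_term q (2 * k + 2 + m) (2 * k + 2)
      = 2 * q ^ ?e * (q ^ (2 * k\<^sup>2 + k) * qfac (1 / q\<^sup>2) k)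
        * (q ^ (2 * m\<^sup>2 + m) * qfac (1 / q\<^sup>2) m)"
  proof -
    have "(2 * k + 2) * (2 * k + 2 + 1) = 2 * ((k + 1) * (2 * k + 3))"
      by (simp add: algebra_simps)
    then have "(2 * k + 2) * (2 * k + 2 + 1) div 2 = (k + 1) * (2 * k + 3)"
      by simp
    moreover have "2 * (2 * k + 2 + m) - 2 * (2 * k + 2) = 2 * m" "2 * k + 2 - 2 = 2 * k"
      "2 * k + 2 - 1 = 2 * k + 1"
      by simp_all
    ultimately show ?thesis
      unfolding B_term_def by (simp only: card_Sp_eq[OF q])
  qed
  then have "B_term q (2 * k + 2 + m) (2 * k + 2) * q ^ (2 * k + 2)
      = (q ^ ?e * q ^ (2 * k\<^sup>2 + k) * q ^ (2 * m\<^sup>2 + m) * q ^ (2 * k + 2))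
        * (2 * qfac (1 / q\<^sup>2) k * qfac (1 / q\<^sup>2) m)"
    by (simp only: mult_ac)
  then have "B_term q (2 * k + 2 + m) (2 * k + 2)
      = q ^ ?N * (q\<^sup>2) ^ ?c * (2 * qfac (1 / q\<^sup>2) k * qfac (1 / q\<^sup>2) m) / q ^ (2 * k + 2)"
    unfolding E using q by (simp add: eq_divide_eq)
  then show ?thesis
    using q real_qfac_pos[OF q, of k] real_qfac_pos[OF q, of m]
    by (simp add: power_one_over)
qed

text \<open>The same exponent count as for \<open>B_term\<close>, now with
  \<open>r = 2 * k + 1\<close>. The result has the same shape,
  \<open>q ^ r / qfac (1 / q\<^sup>2) k\<close> times the same factor in \<open>m\<close>, so the
  two sums can be merged.\<close>

lemma C_term_factor:
  assumes q: "q > 1"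
  shows "q ^ ((2 * k + 1 + m)\<^sup>2) / C_term q (2 * k + 1 + m) (2 * k + 1)
    = q ^ (2 * k + 1) / qfac (1 / q\<^sup>2) k
      * (1 / 2 * ((1 / q\<^sup>2) ^ (m choose 2) / qfac (1 / q\<^sup>2) m))"
proof -
  let ?N = "(2 * k + 1 + m)\<^sup>2" and ?c = "m choose 2"
  let ?e = "(2 * k + 1) * k + 2 * k * (2 * m)"
  have "2 * ?c + m = m\<^sup>2"
    by (rule choose_two_double)
  then have "?e + (2 * k\<^sup>2 + k) + (2 * m\<^sup>2 + m) + (2 * k + 1) = ?N + 2 * ?c"
    by (simp add: power2_eq_square algebra_simps)
  then have E: "q ^ ?e * q ^ (2 * k\<^sup>2 + k) * q ^ (2 * m\<^sup>2 + m) * q ^ (2 * k + 1) = q ^ ?N * (q\<^sup>2) ^ ?c"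
    unfolding power_add[symmetric] power_mult[symmetric] by simp
  have "C_term q (2 * k + 1 + m) (2 * k + 1)
      = 2 * q ^ ?e * (q ^ (2 * k\<^sup>2 + k) * qfac (1 / q\<^sup>2) k)
        * (q ^ (2 * m\<^sup>2 + m) * qfac (1 / q\<^sup>2) m)"
  proof -
    have "(2 * k + 1) * (2 * k + 1 - 1) = 2 * ((2 * k + 1) * k)"
      by (simp add: algebra_simps)
    then have "(2 * k + 1) * (2 * k + 1 - 1) div 2 = (2 * k + 1) * k"
      by simp
    moreover have "2 * (2 * k + 1 + m) - 2 * (2 * k + 1) = 2 * m" "2 * k + 1 - 1 = 2 * k"
      by simp_all
    ultimately show ?thesis
      unfolding C_term_def by (simp only: card_Sp_eq[OF q])
  qed
  then have "C_term q (2 * k + 1 + m) (2 * k + 1) * q ^ (2 * k + 1)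
      = (q ^ ?e * q ^ (2 * k\<^sup>2 + k) * q ^ (2 * m\<^sup>2 + m) * q ^ (2 * k + 1))
        * (2 * qfac (1 / q\<^sup>2) k * qfac (1 / q\<^sup>2) m)"
    by (simp only: mult_ac)
  then have "C_term q (2 * k + 1 + m) (2 * k + 1)
      = q ^ ?N * (q\<^sup>2) ^ ?c * (2 * qfac (1 / q\<^sup>2) k * qfac (1 / q\<^sup>2) m) / q ^ (2 * k + 1)"
    unfolding E using q by (simp add: eq_divide_eq)
  then show ?thesis
    using q real_qfac_pos[OF q, of k] real_qfac_pos[OF q, of m]
    by (simp add: power_one_over)
qed

section \<open>Series supported on even indices and Cauchy products\<close>

text \<open>Padding with zeros at odd indices turns a sum over even \<open>r\<close> into an
  ordinary Cauchy product in \<open>r\<close> and \<open>n - r\<close>.\<close>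

lemma sums_spread_even:
  fixes f :: "nat \<Rightarrow> 'a::real_normed_vector"
  assumes "f sums c"
  shows "(\<lambda>r. if even r then f (r div 2) else 0) sums c"
proof -
  have "strict_mono (\<lambda>n::nat. 2 * n)"
    by (simp add: strict_mono_def)
  from sums_mono_reindex[OF this, of "\<lambda>r. if even r then f (r div 2) else 0" c] assms
  show ?thesis
    by (fastforce elim: evenE)
qed

lemma summable_norm_spread_even:
  fixes f :: "nat \<Rightarrow> 'a::real_normed_vector"
  assumes "summable (\<lambda>k. norm (f k))"
  shows "summable (\<lambda>r. norm (if even r then f (r div 2) else 0))"
proof -
  have "(\<lambda>r. norm (if even r then f (r div 2) else 0))
      = (\<lambda>r. if even r then norm (f (r div 2)) else 0)"
    by auto
  then show ?thesis
    using sums_summable[OF sums_spread_even[OF summable_sums[OF assms]]] by simp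
qed

lemma sums_Cauchy_product:
  fixes a b :: "nat \<Rightarrow> 'a::{real_normed_algebra,banach}"
  assumes "summable (\<lambda>k. norm (a k))" "summable (\<lambda>k. norm (b k))" "a sums s" "b sums t"
  shows "(\<lambda>n. \<Sum>r\<le>n. a r * b (n - r)) sums (s * t)"
  using Cauchy_product_sums[OF assms(1,2)]
  unfolding sums_unique[OF assms(3), symmetric] sums_unique[OF assms(4), symmetric] .

section \<open>Assembly of the generating function\<close>

theorem theorem2p14:
  fixes q :: real and u :: complex
  assumes "q > 1" and "norm u < 1 / q"
  shows "(\<lambda>n. complex_of_real q ^ (n\<^sup>2) * u ^ n *
            complex_of_real
              ((\<Sum>r\<in>{r\<in>{0..n}. even r}. 1 / A_term q n r)
             + (\<Sum>r\<in>{r\<in>{1..n}. even r}. 1 / B_term q n r)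
             + (\<Sum>r\<in>{r\<in>{1..n}. odd r}. 1 / C_term q n r)))
         sums
          (1 / (2 * (1 - u * complex_of_real q))
             * ((\<Prod>i. 1 + u / complex_of_real q ^ (2 * i))
                / (\<Prod>i. 1 - u\<^sup>2 / complex_of_real q ^ (2 * i)))
           + 1 / 2
             * ((\<Prod>i. 1 + u / complex_of_real q ^ (2 * i + 1))
                / (\<Prod>i. 1 - u\<^sup>2 / complex_of_real q ^ (2 * i))))"
proof -
  define Q where "Q = complex_of_real q"
  define p where "p = 1 / Q\<^sup>2"
  have Q0: "Q \<noteq> 0"
    using assms by (simp add: Q_def)
  have p_real: "p = of_real (1 / q\<^sup>2)"
    by (simp add: p_def Q_def)
  have p: "norm p < 1"
    using assms by (simp add: p_def Q_def norm_divide norm_power one_less_power)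
  have uq: "norm (u * Q) < 1"
    using assms by (simp add: Q_def norm_mult field_simps)
  have u1: "norm u < 1"
    using assms by (smt (verit) divide_less_eq_1)
  have u2: "norm (u\<^sup>2) < 1" and uq2: "norm ((u * Q)\<^sup>2) < 1"
    using u1 uq by (simp_all add: norm_power abs_square_less_1 del: norm_mult)
  have uq_ne: "1 - u * Q \<noteq> 0" "1 + u * Q \<noteq> 0"
  proof -
    show "1 - u * Q \<noteq> 0"
      using uq by auto
    show "1 + u * Q \<noteq> 0"
    proof
      assume "1 + u * Q = 0"
      then have "u * Q = - 1"
        by (metis minus_unique)
      then have "norm (u * Q) = 1"
        by (simp only: norm_minus_cancel norm_one)
      with uq show False by simp
    qed
  qed

  define D where "D = (\<Prod>i. 1 - u\<^sup>2 * p ^ i)"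
  define P0 where "P0 = (\<Prod>i. 1 + u * p ^ i)"
  define P1 where "P1 = (\<Prod>i. 1 + u / Q * p ^ i)"
  have p_power: "p ^ i = 1 / Q ^ (2 * i)" for i
    by (simp add: p_def power_one_over power_mult)
  have D_eq: "D = (\<Prod>i. 1 - u\<^sup>2 / Q ^ (2 * i))"
    and P0_eq: "P0 = (\<Prod>i. 1 + u / Q ^ (2 * i))"
    and P1_eq: "P1 = (\<Prod>i. 1 + u / Q ^ (2 * i + 1))"
    by (simp_all add: D_def P0_def P1_def p_power)

  \<comment> \<open>The factors in \<open>r\<close> and \<open>n - r\<close> with the powers of
    \<open>u\<close> absorbed: \<open>\<alpha>\<close> belongs to the A sum, \<open>\<gamma>\<close>
    to the B and C sums together, and \<open>E\<close> to \<open>n - r\<close>. The index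
    \<open>(r - 1) div 2\<close> equals \<open>k\<close> for both \<open>r = 2 * k + 1\<close> and
    \<open>r = 2 * k + 2\<close>; the value 0 at \<open>r = 0\<close> reflects that those sums start
    at 1.\<close>
  define \<alpha> where "\<alpha> = (\<lambda>r. if even r then (u\<^sup>2) ^ (r div 2) / qfac p (r div 2) else 0)"
  define E where "E = (\<lambda>z m. p ^ (m choose 2) * z ^ m / qfac p m)"
  define \<gamma> where "\<gamma> r = (if r = 0 then 0 else (u * Q) ^ r / qfac p ((r - 1) div 2))" for r

  have \<alpha>_sums: "\<alpha> sums (1 / D)"
    using sums_spread_even[OF euler_inverse_sums[OF p u2]] by (simp add: \<alpha>_def D_def)
  have \<alpha>_norm: "summable (\<lambda>r. norm (\<alpha> r))"
    unfolding \<alpha>_def by (rule summable_norm_spread_even[OF summable_norm_euler_inverse[OF p u2]])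
  have E_sums: "E z sums (\<Prod>i. 1 + z * p ^ i)" and E_norm: "summable (\<lambda>m. norm (E z m))" for z
    unfolding E_def by (rule euler_prod_sums[OF p], rule summable_norm_euler_prod[OF p])

  have F: "(\<lambda>k. ((u * Q)\<^sup>2) ^ k / qfac p k) sums (1 / ((1 - (u * Q)\<^sup>2) * D))"
  proof -
    have "p * (u * Q)\<^sup>2 = u\<^sup>2"
      using Q0 by (simp add: p_def power_mult_distrib)
    with euler_inverse_functional_equation[OF p uq2]
    have "1 / D = (1 - (u * Q)\<^sup>2) * (\<Sum>k. ((u * Q)\<^sup>2) ^ k / qfac p k)"
      using euler_inverse_sums[OF p u2] by (simp add: sums_iff D_def)
    moreover have "1 - (u * Q)\<^sup>2 \<noteq> 0"
      using uq2 by auto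
    ultimately have "(\<Sum>k. ((u * Q)\<^sup>2) ^ k / qfac p k) = 1 / ((1 - (u * Q)\<^sup>2) * D)"
      by (metis divide_divide_eq_left mult.commute nonzero_mult_div_cancel_left)
    then show ?thesis
      using summable_norm_cancel[OF summable_norm_euler_inverse[OF p uq2]] by (simp add: sums_iff)
  qed

  define \<epsilon> where "\<epsilon> = (\<lambda>r. if even r then ((u * Q)\<^sup>2) ^ (r div 2) / qfac p (r div 2) else 0)"
  have \<epsilon>_sums: "\<epsilon> sums (1 / ((1 - (u * Q)\<^sup>2) * D))"
    using sums_spread_even[OF F] by (simp add: \<epsilon>_def)
  have \<epsilon>_norm: "summable (\<lambda>r. norm (\<epsilon> r))"
    unfolding \<epsilon>_def by (rule summable_norm_spread_even[OF summable_norm_euler_inverse[OF p uq2]])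
  define \<epsilon>' where "\<epsilon>' r = (case r of 0 \<Rightarrow> 0 | Suc r \<Rightarrow> \<epsilon> r)" for r
  have \<epsilon>'_sums: "\<epsilon>' sums (1 / ((1 - (u * Q)\<^sup>2) * D))"
    using sums_Suc_iff[of \<epsilon>'] \<epsilon>_sums by (simp add: \<epsilon>'_def)
  have \<epsilon>'_norm: "summable (\<lambda>r. norm (\<epsilon>' r))"
    using \<epsilon>_norm by (subst summable_Suc_iff[symmetric]) (simp add: \<epsilon>'_def)
  \<comment> \<open>For \<open>r = 2 * k\<close> only \<open>\<epsilon>\<close> contributes and
    yields the C factor at \<open>2 * k + 1\<close>; for \<open>r = 2 * k + 1\<close> only the
    shifted \<open>\<epsilon>'\<close> contributes and yields the B factor at
    \<open>2 * k + 2\<close>.\<close>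
  have \<gamma>_Suc: "\<gamma> (Suc r) = u * Q * \<epsilon> r + (u * Q) * (u * Q) * \<epsilon>' r" for r
  proof (cases "even r")
    case True
    then obtain k where "r = 2 * k" by blast
    then show ?thesis
      by (cases k) (simp_all add: \<gamma>_def \<epsilon>_def \<epsilon>'_def power_mult power2_eq_square power_mult_distrib mult_ac)
  next
    case False
    then obtain k where "r = 2 * k + 1" by (blast elim: oddE)
    then show ?thesis
      by (simp add: \<gamma>_def \<epsilon>_def \<epsilon>'_def power_mult power2_eq_square power_mult_distrib mult_ac)
  qed
  have \<gamma>_sums: "\<gamma> sums (u * Q / ((1 - u * Q) * D))"
  proof -
    let ?S = "1 / ((1 - (u * Q)\<^sup>2) * D)"
    have "(\<lambda>r. \<gamma> (Suc r)) sums (u * Q * ?S + (u * Q) * (u * Q) * ?S)"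
      unfolding \<gamma>_Suc using \<epsilon>_sums \<epsilon>'_sums by (intro sums_add sums_mult)
    then have "\<gamma> sums (u * Q * ?S + (u * Q) * (u * Q) * ?S)"
      by (subst (asm) sums_Suc_iff) (simp add: \<gamma>_def)
    \<comment> \<open>With \<open>x = u * Q\<close> this is
      \<open>(x + x^2) / (1 - x^2) = x / (1 - x)\<close>, where \<open>1 + x\<close> is
      nonzero.\<close>
    also have "u * Q * ?S + (u * Q) * (u * Q) * ?S
        = (u * Q) * (1 + u * Q) / ((1 + u * Q) * ((1 - u * Q) * D))"
    proof -
      have factor: "(1 - (u * Q)\<^sup>2) * D = (1 + u * Q) * ((1 - u * Q) * D)"
        by (simp add: power2_eq_square algebra_simps)
      show ?thesis
        unfolding factor
        by (simp only: distrib_left add_divide_distrib times_divide_eq_right mult_1_right)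
    qed
    also have "\<dots> = u * Q / ((1 - u * Q) * D)"
      using uq_ne(2) by simp
    finally show ?thesis .
  qed
  have \<gamma>_norm: "summable (\<lambda>r. norm (\<gamma> r))"
  proof (subst summable_Suc_iff[symmetric], rule summable_comparison_test')
    show "summable (\<lambda>r. norm (u * Q) * norm (\<epsilon> r) + norm ((u * Q) * (u * Q)) * norm (\<epsilon>' r))"
      by (intro summable_add summable_mult \<epsilon>_norm \<epsilon>'_norm)
    show "norm (norm (\<gamma> (Suc r)))
        \<le> norm (u * Q) * norm (\<epsilon> r) + norm ((u * Q) * (u * Q)) * norm (\<epsilon>' r)" for r
      using norm_triangle_ineq[of "u * Q * \<epsilon> r" "(u * Q) * (u * Q) * \<epsilon>' r"]
      by (simp add: \<gamma>_Suc norm_mult)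
  qed

  have A_part: "(\<lambda>n. \<Sum>r\<le>n. \<alpha> r * (1 / 2 * (E u (n - r) + E (u / Q) (n - r))))
      sums (1 / D * (1 / 2 * (P0 + P1)))"
  proof -
    have "(\<lambda>m. 1 / 2 * (E u m + E (u / Q) m)) sums (1 / 2 * (P0 + P1))"
      unfolding P0_def P1_def by (intro sums_mult sums_add E_sums)
    moreover have "summable (\<lambda>m. norm (1 / 2 * (E u m + E (u / Q) m)))"
    proof (rule summable_comparison_test')
      show "summable (\<lambda>m. norm (E u m) + norm (E (u / Q) m))"
        by (intro summable_add E_norm)
      show "norm (norm (1 / 2 * (E u m + E (u / Q) m))) \<le> norm (E u m) + norm (E (u / Q) m)" for m
        using norm_triangle_ineq[of "E u m" "E (u / Q) m"]
        by (simp add: norm_mult) (smt (verit) norm_ge_zero)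
    qed
    ultimately show ?thesis
      using sums_Cauchy_product[OF \<alpha>_norm _ \<alpha>_sums, of "\<lambda>m. 1 / 2 * (E u m + E (u / Q) m)"]
      by (simp only:)
  qed
  have BC_part: "(\<lambda>n. \<Sum>r\<le>n. \<gamma> r * (1 / 2 * E u (n - r)))
      sums (u * Q / ((1 - u * Q) * D) * (1 / 2 * P0))"
  proof -
    have "(\<lambda>m. 1 / 2 * E u m) sums (1 / 2 * P0)"
      unfolding P0_def by (intro sums_mult E_sums)
    moreover have "summable (\<lambda>m. norm (1 / 2 * E u m))"
      using summable_mult[OF E_norm[of u], of "1 / 2"] by (simp add: norm_mult)
    ultimately show ?thesis
      using sums_Cauchy_product[OF \<gamma>_norm _ \<gamma>_sums, of "\<lambda>m. 1 / 2 * E u m"] by (simp only:)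
  qed

  have A_coeff: "Q ^ n\<^sup>2 * u ^ n * of_real (1 / A_term q n r)
      = \<alpha> r * (1 / 2 * (E u (n - r) + E (u / Q) (n - r)))" if "r \<le> n" "even r" for n r
  proof -
    obtain k m where km: "r = 2 * k" "n = 2 * k + m"
      using \<open>even r\<close> le_Suc_ex[OF \<open>r \<le> n\<close>] by blast
    have "Q ^ n\<^sup>2 * of_real (1 / A_term q n r)
        = 1 / qfac p k * (1 / 2 * (p ^ (m choose 2) * (1 + (1 / Q) ^ m) / qfac p m))"
      using arg_cong[OF A_term_factor[OF assms(1), of k m], of complex_of_real]
      by (simp add: km p_real Q_def of_real_qfac)
    then have "Q ^ n\<^sup>2 * u ^ n * of_real (1 / A_term q n r)
        = u ^ n * (1 / qfac p k * (1 / 2 * (p ^ (m choose 2) * (1 + (1 / Q) ^ m) / qfac p m)))"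
      by (simp only: mult_ac)
    \<comment> \<open>Here \<open>u ^ n\<close> splits as \<open>u ^ (2 * k) * u ^ m\<close>, and
      \<open>(1 / Q) ^ m\<close> merges with \<open>u ^ m\<close> to give the term of
      \<open>E (u / Q)\<close>.\<close>
    also have "\<dots> = \<alpha> r * (1 / 2 * (E u (n - r) + E (u / Q) (n - r)))"
      by (simp add: km \<alpha>_def E_def power_add power_mult power_divide add_divide_distrib distrib_left)
        (simp only: mult_ac)
    finally show ?thesis .
  qed
  have BC_coeff: "Q ^ n\<^sup>2 * u ^ n * of_real (if even r then 1 / B_term q n r else 1 / C_term q n r)
      = \<gamma> r * (1 / 2 * E u (n - r))" if "r \<in> {1..n}" for n r
  proof -
    have "r \<le> n"
      using that by simp
    then obtain m where m: "n = r + m"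
      using le_Suc_ex by blast
    have "Q ^ n\<^sup>2 * of_real (if even r then 1 / B_term q n r else 1 / C_term q n r)
        = Q ^ r / qfac p ((r - 1) div 2) * (1 / 2 * (p ^ (m choose 2) / qfac p m))"
    proof (cases "even r")
      case True
      then obtain j where "r = 2 * j" by blast
      \<comment> \<open>An even \<open>r\<close> in the range is at least 2, since the B sum starts
        at \<open>r = 1\<close>.\<close>
      with that obtain k where r: "r = 2 * k + 2"
        by (cases j) auto
      then show ?thesis
        using arg_cong[OF B_term_factor[OF assms(1), of k m], of complex_of_real]
        by (simp add: m p_real Q_def of_real_qfac)
    next
      case False
      then obtain k where r: "r = 2 * k + 1" by (blast elim: oddE)
      then show ?thesis
        using arg_cong[OF C_term_factor[OF assms(1), of k m], of complex_of_real]
        by (simp add: m p_real Q_def of_real_qfac)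
    qed
    then have "Q ^ n\<^sup>2 * u ^ n * of_real (if even r then 1 / B_term q n r else 1 / C_term q n r)
        = u ^ n * (Q ^ r / qfac p ((r - 1) div 2) * (1 / 2 * (p ^ (m choose 2) / qfac p m)))"
      by (simp only: mult_ac)
    also have "\<dots> = \<gamma> r * (1 / 2 * E u (n - r))"
      using that by (simp add: m \<gamma>_def E_def power_add power_mult_distrib)
    finally show ?thesis .
  qed

  have coeff: "Q ^ n\<^sup>2 * u ^ n *
        of_real ((\<Sum>r\<in>{r\<in>{0..n}. even r}. 1 / A_term q n r)
          + (\<Sum>r\<in>{r\<in>{1..n}. even r}. 1 / B_term q n r)
          + (\<Sum>r\<in>{r\<in>{1..n}. odd r}. 1 / C_term q n r))
      = (\<Sum>r\<le>n. \<alpha> r * (1 / 2 * (E u (n - r) + E (u / Q) (n - r))))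
        + (\<Sum>r\<le>n. \<gamma> r * (1 / 2 * E u (n - r)))" for n
  proof -
    have "Q ^ n\<^sup>2 * u ^ n * of_real (\<Sum>r\<in>{r\<in>{0..n}. even r}. 1 / A_term q n r)
        = (\<Sum>r\<in>{r\<in>{0..n}. even r}. \<alpha> r * (1 / 2 * (E u (n - r) + E (u / Q) (n - r))))"
      unfolding of_real_sum sum_distrib_left by (intro sum.cong refl A_coeff) auto
    also have "\<dots> = (\<Sum>r\<le>n. \<alpha> r * (1 / 2 * (E u (n - r) + E (u / Q) (n - r))))"
      by (intro sum.mono_neutral_left) (auto simp: \<alpha>_def)
    finally have A: "Q ^ n\<^sup>2 * u ^ n * of_real (\<Sum>r\<in>{r\<in>{0..n}. even r}. 1 / A_term q n r)
        = (\<Sum>r\<le>n. \<alpha> r * (1 / 2 * (E u (n - r) + E (u / Q) (n - r))))" .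
    have "(\<Sum>r\<in>{r\<in>{1..n}. even r}. 1 / B_term q n r) + (\<Sum>r\<in>{r\<in>{1..n}. odd r}. 1 / C_term q n r)
        = (\<Sum>r=1..n. if even r then 1 / B_term q n r else 1 / C_term q n r)"
      unfolding sum.inter_filter[OF finite_atLeastAtMost] sum.distrib[symmetric]
      by (rule sum.cong) auto
    then have "Q ^ n\<^sup>2 * u ^ n * of_real ((\<Sum>r\<in>{r\<in>{1..n}. even r}. 1 / B_term q n r)
          + (\<Sum>r\<in>{r\<in>{1..n}. odd r}. 1 / C_term q n r))
        = (\<Sum>r=1..n. Q ^ n\<^sup>2 * u ^ n *
            of_real (if even r then 1 / B_term q n r else 1 / C_term q n r))"
      by (simp only: of_real_sum sum_distrib_left)
    also have "\<dots> = (\<Sum>r=1..n. \<gamma> r * (1 / 2 * E u (n - r)))"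
      by (intro sum.cong refl BC_coeff)
    \<comment> \<open>The value of \<open>\<gamma>\<close> at 0 lets the range include
      \<open>r = 0\<close>, as the Cauchy product requires.\<close>
    also have "\<dots> = (\<Sum>r\<le>n. \<gamma> r * (1 / 2 * E u (n - r)))"
      by (intro sum.mono_neutral_left) (auto simp: \<gamma>_def)
    finally show ?thesis
      unfolding A[symmetric] by (simp only: of_real_add distrib_left add.assoc)
  qed

  have "1 / D * (1 / 2 * (P0 + P1)) + u * Q / ((1 - u * Q) * D) * (1 / 2 * P0)
      = 1 / (2 * (1 - u * Q)) * (P0 / D) + 1 / 2 * (P1 / D)"
  proof -
    \<comment> \<open>\<open>P0\<close> comes from the A sum with weight 1 and from the B and C sums
      with weight \<open>u * Q / (1 - u * Q)\<close>; \<open>P1\<close> comes from the A sum alone.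
      This explains the factor \<open>1 / (1 - u * q)\<close> in just one of the two final
      terms.\<close>
    have "1 + u * Q / (1 - u * Q) = 1 / (1 - u * Q)"
      using uq_ne(1) by (simp add: field_simps)
    then have "1 / 2 * (P0 / D) * (1 + u * Q / (1 - u * Q)) = 1 / (2 * (1 - u * Q)) * (P0 / D)"
      by simp
    then show ?thesis
      by (simp add: algebra_simps add_divide_distrib)
  qed
  with sums_add[OF A_part BC_part] show ?thesis
    unfolding Q_def[symmetric] coeff D_eq[symmetric] P0_eq[symmetric] P1_eq[symmetric] by simp
qed

end
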